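(* Let $d\ge2$ and let $x,y\in\mathbb{R}^{d-1,1}$ be timelike separated, the past and future tips of a causal diamond. Consider a family, indexed by small $\varepsilon>0$, of string segments in $AdS_{d+1}$ satisfying the causality conditions (see context), whose boundary points are $$x_1=x,\qquad x_4=y,\qquad x_3=x+\varepsilon\,\xi+O(\varepsilon^2),\qquad x_2=y+\varepsilon\,\eta+O(\varepsilon^2)$$ with fixed $\xi,\eta\in\mathbb{R}^{d-1,1}$. Then the world sheet area $A_\diamond(\varepsilon)$ of the segment satisfies, to leading order, $$\frac{A_\diamond(\varepsilon)}{L^2}=\frac{\varepsilon^2}{2\ell^2}\,h_{\mu\nu}(x,y)\,\xi^\mu\eta^\nu+o(\varepsilon^2),\qquad h_{\mu\nu}(x,y)=\frac{4\ell^2}{(x-y)^2}\left[-\eta_{\mu\nu}+\frac{2(x_\mu-y_\mu)(x_\nu-y_\nu)}{(x-y)^2}\right],$$ i.e. $\delta A_\diamond/L^2=\frac{1}{2\ell^2}ds^2_{\mathcal K}$, where $ds^2_{\mathcal K}=h_{\mu\nu}dx^\mu dy^\nu$ is the metric on kinematic space.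
   Context: $\mathbb{R}^{d-1,1}$ has metric $\eta_{\mu\nu}=\mathrm{diag}(-1,1,\dots,1)$, product $x\bullet y=\eta_{\mu\nu}x^\mu y^\nu$, $(x-y)^2=(x-y)\bullet(x-y)$, and indices are lowered with $\eta_{\mu\nu}$. (The vector $\eta=(\eta^\mu)$ is not to be confused with the metric $\eta_{\mu\nu}$.) The number $\ell>0$ is an arbitrary length scale. Kinematic space $\mathcal{K}$ is the moduli space of causal diamonds, parametrized by pairs $(x,y)$ of past and future tips. $\mathbb{R}^{2,d}$ has coordinates $X^{-1},X^0,X^1,\dots,X^d$ and bilinear form $X\cdot Y=-X^{-1}Y^{-1}-X^0Y^0+\sum_{k=1}^dX^kY^k$; $X^\pm=X^1\pm X^{-1}$. $AdS_{d+1}=\{X: X\cdot X=-L^2\}$, $L>0$. A string segment is given by $V_1\in AdS_{d+1}$ and null vectors $p_1,p_4\in\mathbb{R}^{2,d}$ with $p_1\cdot V_1=p_4\cdot V_1=0$. Its world sheet is the image of $$X(\sigma^-,\sigma^+)=\frac{L^2+\sigma^-\sigma^+\frac12 p_1\cdot p_4}{L^2-\sigma^-\sigma^+\frac12 p_1\cdot p_4}V_1+L^2\frac{\sigma^-p_1+\sigma^+p_4}{L^2-\sigma^-\sigma^+\frac12 p_1\cdot p_4},\qquad \sigma^\pm\in[0,1],$$ with vertices $V_2=X(1,0)$, $V_4=X(0,1)$, $V_3=X(1,1)$, and $p_2=V_3-V_2$, $p_3=V_3-V_4$. $A_\diamond=\int_0^1\int_0^1\sqrt{-\det(\partial_\alpha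 X\cdot\partial_\beta X)}\,d\sigma^-d\sigma^+$ is its Lorentzian area. Its boundary points (assuming $p_i^-\neq0$) are $x_i=\frac{L}{p_i^-}(p_i^0,p_i^2,\dots,p_i^d)\in\mathbb{R}^{d-1,1}$, with time components $t_i$. Causality conditions: $V_i^->0$ for all $i$; $p_1\cdot p_4<0$; $(x_i-x_j)^2<0$ for the neighbouring edges $(ij)=(12),(23),(34),(14)$; and $t_1<t_3<t_4<t_2$. *)

theory Defs
  imports "HOL-Analysis.Analysis" "HOL-Library.Landau_Symbols"
begin

text \<open>
  The finite type \<open>'n\<close> indexes the directions \<open>2, \<dots>, d\<close>, so \<open>d = CARD('n) + 1\<close>. Since types are
  nonempty, \<open>'n\<close> ranging over all finite types is the same as \<open>d\<close> ranging over all \<open>d \<ge> 2\<close>.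
  In \<open>\<real>\<^bsup>d-1,1\<^esup>\<close> the index \<open>None\<close> is the time direction \<open>0\<close> and \<open>Some k\<close> is a spatial direction.
\<close>

type_synonym 'n mink = "real ^ ('n option)"

definition eta :: "'n option \<Rightarrow> 'n option \<Rightarrow> real" where
  "eta \<mu> \<nu> = (if \<mu> \<noteq> \<nu> then 0 else if \<mu> = None then -1 else 1)"

definition mprod :: "'n::finite mink \<Rightarrow> 'n mink \<Rightarrow> real" where
  "mprod x y = (\<Sum>\<mu>\<in>UNIV. \<Sum>\<nu>\<in>UNIV. eta \<mu> \<nu> * x $ \<mu> * y $ \<nu>)"

definition msq :: "'n::finite mink \<Rightarrow> real" where
  "msq x = mprod x x"

definition lower :: "'n::finite mink \<Rightarrow> 'n option \<Rightarrow> real" where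
  "lower x \<mu> = (\<Sum>\<nu>\<in>UNIV. eta \<mu> \<nu> * x $ \<nu>)"

definition time :: "'n::finite mink \<Rightarrow> real" where
  "time x = x $ None"

text \<open>Causal diamonds, given by their past tip and their future tip.\<close>

definition kinematic_space :: "('n::finite mink \<times> 'n mink) set" where
  "kinematic_space = {(x, y). msq (x - y) < 0 \<and> time x < time y}"

definition kin_metric ::
    "real \<Rightarrow> 'n::finite mink \<Rightarrow> 'n mink \<Rightarrow> 'n option \<Rightarrow> 'n option \<Rightarrow> real" where
  "kin_metric ell x y \<mu> \<nu> =
     4 * ell\<^sup>2 / msq (x - y) *
       (- eta \<mu> \<nu> + 2 * (lower x \<mu> - lower y \<mu>) * (lower x \<nu> - lower y \<nu>) / msq (x - y))"

definition kin_ds2 ::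
    "real \<Rightarrow> 'n::finite mink \<Rightarrow> 'n mink \<Rightarrow> 'n mink \<Rightarrow> 'n mink \<Rightarrow> real" where
  "kin_ds2 ell x y dx dy =
     (\<Sum>\<mu>\<in>UNIV. \<Sum>\<nu>\<in>UNIV. kin_metric ell x y \<mu> \<nu> * dx $ \<mu> * dy $ \<nu>)"

text \<open>Points of \<open>\<real>\<^bsup>2,d\<^esup>\<close> are tuples \<open>(X\<^bsup>-1\<^esup>, X\<^bsup>0\<^esup>, X\<^bsup>1\<^esup>, (X\<^bsup>2\<^esup>, \<dots>, X\<^bsup>d\<^esup>))\<close>.\<close>

type_synonym 'n ambient = "real \<times> real \<times> real \<times> (real ^ 'n)"

definition adot :: "'n::finite ambient \<Rightarrow> 'n ambient \<Rightarrow> real" where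
  "adot = (\<lambda>(Xm1, X0, X1, Xs) (Ym1, Y0, Y1, Ys).
     - Xm1 * Ym1 - X0 * Y0 + X1 * Y1 + (\<Sum>k\<in>UNIV. Xs $ k * Ys $ k))"

text \<open>The light-cone coordinate \<open>X\<^sup>- = X\<^bsup>1\<^esup> - X\<^bsup>-1\<^esup>\<close>.\<close>

definition lc_minus :: "'n::finite ambient \<Rightarrow> real" where
  "lc_minus = (\<lambda>(Xm1, X0, X1, Xs). X1 - Xm1)"

definition AdS :: "real \<Rightarrow> 'n::finite ambient set" where
  "AdS L = {X. adot X X = - (L\<^sup>2)}"

text \<open>The coordinates \<open>(X\<^bsup>0\<^esup>, X\<^bsup>2\<^esup>, \<dots>, X\<^bsup>d\<^esup>)\<close>.\<close>

definition mink_part :: "'n::finite ambient \<Rightarrow> 'n mink" where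
  "mink_part = (\<lambda>(Xm1, X0, X1, Xs). \<chi> \<mu>. case \<mu> of None \<Rightarrow> X0 | Some k \<Rightarrow> Xs $ k)"

definition boundary_point :: "real \<Rightarrow> 'n::finite ambient \<Rightarrow> 'n mink" where
  "boundary_point L p = (L / lc_minus p) *\<^sub>R mink_part p"

definition string_segment ::
    "real \<Rightarrow> 'n::finite ambient \<Rightarrow> 'n ambient \<Rightarrow> 'n ambient \<Rightarrow> bool" where
  "string_segment L V1 p1 p4 \<longleftrightarrow>
     V1 \<in> AdS L \<and> adot p1 p1 = 0 \<and> adot p4 p4 = 0 \<and> adot p1 V1 = 0 \<and> adot p4 V1 = 0"

text \<open>In the following functions the last two arguments are \<open>\<sigma>\<^sup>-\<close> and \<open>\<sigma>\<^sup>+\<close>, in this order.\<close>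

definition world_sheet ::
    "real \<Rightarrow> 'n::finite ambient \<Rightarrow> 'n ambient \<Rightarrow> 'n ambient \<Rightarrow> real \<Rightarrow> real \<Rightarrow> 'n ambient" where
  "world_sheet L V1 p1 p4 sm sp =
     ((L\<^sup>2 + sm * sp * (1/2) * adot p1 p4) / (L\<^sup>2 - sm * sp * (1/2) * adot p1 p4)) *\<^sub>R V1
     + (L\<^sup>2 / (L\<^sup>2 - sm * sp * (1/2) * adot p1 p4)) *\<^sub>R (sm *\<^sub>R p1 + sp *\<^sub>R p4)"

definition induced_metric ::
    "real \<Rightarrow> 'n::finite ambient \<Rightarrow> 'n ambient \<Rightarrow> 'n ambient \<Rightarrow> real \<Rightarrow> real \<Rightarrow> real^2^2" where
  "induced_metric L V1 p1 p4 sm sp =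
     (let dm = vector_derivative (\<lambda>s. world_sheet L V1 p1 p4 s sp) (at sm);
          dp = vector_derivative (\<lambda>s. world_sheet L V1 p1 p4 sm s) (at sp)
      in vector [vector [adot dm dm, adot dm dp], vector [adot dp dm, adot dp dp]])"

definition area ::
    "real \<Rightarrow> 'n::finite ambient \<Rightarrow> 'n ambient \<Rightarrow> 'n ambient \<Rightarrow> real" where
  "area L V1 p1 p4 =
     integral {0..1} (\<lambda>sp. integral {0..1} (\<lambda>sm.
       sqrt (- det (induced_metric L V1 p1 p4 sm sp))))"

definition vertex2 ::
    "real \<Rightarrow> 'n::finite ambient \<Rightarrow> 'n ambient \<Rightarrow> 'n ambient \<Rightarrow> 'n ambient" where
  "vertex2 L V1 p1 p4 = world_sheet L V1 p1 p4 1 0"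

definition vertex3 ::
    "real \<Rightarrow> 'n::finite ambient \<Rightarrow> 'n ambient \<Rightarrow> 'n ambient \<Rightarrow> 'n ambient" where
  "vertex3 L V1 p1 p4 = world_sheet L V1 p1 p4 1 1"

definition vertex4 ::
    "real \<Rightarrow> 'n::finite ambient \<Rightarrow> 'n ambient \<Rightarrow> 'n ambient \<Rightarrow> 'n ambient" where
  "vertex4 L V1 p1 p4 = world_sheet L V1 p1 p4 0 1"

definition edge2 ::
    "real \<Rightarrow> 'n::finite ambient \<Rightarrow> 'n ambient \<Rightarrow> 'n ambient \<Rightarrow> 'n ambient" where
  "edge2 L V1 p1 p4 = vertex3 L V1 p1 p4 - vertex2 L V1 p1 p4"

definition edge3 ::
    "real \<Rightarrow> 'n::finite ambient \<Rightarrow> 'n ambient \<Rightarrow> 'n ambient \<Rightarrow> 'n ambient" where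
  "edge3 L V1 p1 p4 = vertex3 L V1 p1 p4 - vertex4 L V1 p1 p4"

text \<open>Without this condition \<open>boundary_point\<close> would divide by zero.\<close>

definition boundary_points_defined ::
    "real \<Rightarrow> 'n::finite ambient \<Rightarrow> 'n ambient \<Rightarrow> 'n ambient \<Rightarrow> bool" where
  "boundary_points_defined L V1 p1 p4 \<longleftrightarrow>
     lc_minus p1 \<noteq> 0 \<and> lc_minus (edge2 L V1 p1 p4) \<noteq> 0 \<and>
     lc_minus (edge3 L V1 p1 p4) \<noteq> 0 \<and> lc_minus p4 \<noteq> 0"

definition causality ::
    "real \<Rightarrow> 'n::finite ambient \<Rightarrow> 'n ambient \<Rightarrow> 'n ambient \<Rightarrow> bool" where
  "causality L V1 p1 p4 \<longleftrightarrow>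
     (let x1 = boundary_point L p1;
          x2 = boundary_point L (edge2 L V1 p1 p4);
          x3 = boundary_point L (edge3 L V1 p1 p4);
          x4 = boundary_point L p4
      in lc_minus V1 > 0 \<and> lc_minus (vertex2 L V1 p1 p4) > 0 \<and>
         lc_minus (vertex3 L V1 p1 p4) > 0 \<and> lc_minus (vertex4 L V1 p1 p4) > 0 \<and>
         adot p1 p4 < 0 \<and>
         msq (x1 - x2) < 0 \<and> msq (x2 - x3) < 0 \<and> msq (x3 - x4) < 0 \<and> msq (x1 - x4) < 0 \<and>
         time x1 < time x3 \<and> time x3 < time x4 \<and> time x4 < time x2)"

end

(* With k = - p1.p4 / 2 > 0 the world sheet is conformal in null coordinates with area density
   2 k L^4 / (L^2 + k s t)^2, so that A / L^2 = 2 ln (1 + k / L^2).  Products of null vectors are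
   p.q = - p^- q^- (x_p - x_q)^2 / (2 L^2), and the scale factors p^- cancel in the cross-ratio
   (p1.p4) (p2.p3) / ((p1.p2) (p3.p4)) = (1 + k / L^2)^2.  Hence

     A / L^2 = ln (x14^2 x23^2 / (x12^2 x34^2)).

   With z = x - y, x3 = x + a and x2 = y + b, this is a second mixed difference of the function
   ln (z^2): it vanishes for a = 0 and for b = 0, so errors of order eps^2 in a and b
   contribute only at order eps^3. *)

theory Submission
  imports Defs
begin

subsection \<open>The two bilinear forms\<close>

lemma UNIV_option_sum:
  fixes f :: "'n::finite option \<Rightarrow> real"
  shows "sum f UNIV = f None + (\<Sum>k\<in>UNIV. f (Some k))"
  by (simp add: UNIV_option_conv sum.reindex)

lemma lower_eq: "lower x \<mu> = (if \<mu> = None then - x $ \<mu> else x $ \<mu>)"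
proof -
  have "lower x \<mu> = (\<Sum>\<nu>\<in>UNIV. if \<nu> = \<mu> then eta \<mu> \<mu> * x $ \<mu> else 0)"
    unfolding lower_def by (rule sum.cong) (auto simp: eta_def)
  then show ?thesis by (simp add: eta_def)
qed

lemma mprod_lower: "mprod x y = (\<Sum>\<mu>\<in>UNIV. lower x \<mu> * y $ \<mu>)"
  unfolding mprod_def lower_def sum_distrib_right
  by (subst sum.swap) (rule sum.cong[OF refl], rule sum.cong[OF refl], simp add: eta_def)

text \<open>The Euclidean inner product with a correction in the time direction. In this shape
  symmetry, bilinearity and continuity are inherited from \<open>inner\<close>.
  \<open>adot_inner\<close> does the same with two time directions.\<close>

lemma mprod_inner: "mprod x y = x \<bullet> y - 2 * x $ None * y $ None"
  by (simp add: mprod_lower lower_eq UNIV_option_sum inner_vec_def)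

lemma mprod_commute: "mprod x y = mprod y x"
  by (simp add: mprod_inner inner_commute)

lemma mprod_simps:
  "mprod (x + y) z = mprod x z + mprod y z" "mprod z (x + y) = mprod z x + mprod z y"
  "mprod (x - y) z = mprod x z - mprod y z" "mprod z (x - y) = mprod z x - mprod z y"
  "mprod (c *\<^sub>R x) y = c * mprod x y" "mprod x (c *\<^sub>R y) = c * mprod x y"
  by (simp_all add: mprod_inner inner_simps algebra_simps)

lemma tendsto_mprod [tendsto_intros]:
  assumes "(f \<longlongrightarrow> a) F" "(g \<longlongrightarrow> b) F"
  shows "((\<lambda>t. mprod (f t) (g t)) \<longlongrightarrow> mprod a b) F"
  unfolding mprod_inner using assms by (auto intro!: tendsto_intros)

lemma adot_inner: "adot X Y = X \<bullet> Y - 2 * fst X * fst Y - 2 * fst (snd X) * fst (snd Y)"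
  by (cases X; cases Y) (simp add: adot_def inner_vec_def inner_prod_def)

lemma adot_commute: "adot X Y = adot Y X"
  by (simp add: adot_inner inner_commute)

lemma adot_simps:
  "adot (x + y) z = adot x z + adot y z" "adot z (x + y) = adot z x + adot z y"
  "adot (c *\<^sub>R x) z = c * adot x z" "adot z (c *\<^sub>R x) = c * adot z x"
  by (simp_all add: adot_inner inner_simps algebra_simps)

text \<open>The number \<open>P\<close> is \<open>p\<^sup>+\<close>; likewise \<open>Q\<close>.\<close>

lemma adot_light_cone:
  fixes p q :: "'n::finite ambient"
  defines "P \<equiv> fst (snd (snd p)) + fst p" and "Q \<equiv> fst (snd (snd q)) + fst q"
  shows "adot p q = (P * lc_minus q + lc_minus p * Q) / 2 + mprod (mink_part p) (mink_part q)"
  by (cases p; cases q)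
     (simp add: P_def Q_def adot_def lc_minus_def mink_part_def mprod_lower lower_eq
        UNIV_option_sum field_simps)

text \<open>Nullness determines the \<open>+\<close> component: it is minus the Minkowski square of
  \<open>mink_part p\<close> over \<open>lc_minus p\<close>. Inserting this for both vectors into
  the light-cone form of the product completes the square of the difference of the rescaled
  Minkowski parts.\<close>

lemma adot_null_boundary_point:
  fixes p q :: "'n::finite ambient"
  assumes "L \<noteq> 0" "adot p p = 0" "adot q q = 0" "lc_minus p \<noteq> 0" "lc_minus q \<noteq> 0"
  shows "adot p q = - lc_minus p * lc_minus q / (2 * L\<^sup>2) *
           msq (boundary_point L p - boundary_point L q)"
proof -
  define P Q m n where "P = fst (snd (snd p)) + fst p" and "Q = fst (snd (snd q)) + fst q"
    and "m = mink_part p" and "n = mink_part q"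
  note defs = P_def Q_def m_def n_def
  have P: "P = - mprod m m / lc_minus p"
    using assms(2,4) adot_light_cone[of p p, folded defs] by (simp add: field_simps)
  have Q: "Q = - mprod n n / lc_minus q"
    using assms(3,5) adot_light_cone[of q q, folded defs] by (simp add: field_simps)
  show ?thesis
    unfolding adot_light_cone[of p q, folded defs] msq_def boundary_point_def P Q
    using assms(1,4,5)
    by (simp add: mprod_simps mprod_commute[of n m] flip: m_def n_def)
       (simp add: field_simps power2_eq_square)
qed

subsection \<open>The area of a segment\<close>

text \<open>Both coordinate tangents are null, so only their mixed product enters the determinant.
  The resulting density has elementary antiderivatives: rational in \<open>s\<close>, then
  logarithmic in \<open>t\<close>.\<close>

lemma area_eq:
  fixes V1 p1 p4 :: "'n::finite ambient"
  assumes L: "L > 0" and seg: "string_segment L V1 p1 p4" and neg: "adot p1 p4 < 0"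
  defines "k \<equiv> - adot p1 p4 / 2"
  shows "area L V1 p1 p4 = L\<^sup>2 * (2 * ln (1 + k / L\<^sup>2))"
proof -
  have k: "k > 0" using neg by (simp add: k_def)
  have L2: "L\<^sup>2 > 0" using L by simp
  have pp: "adot V1 V1 = - (L\<^sup>2)" "adot p1 p1 = 0" "adot p4 p4 = 0" "adot p1 V1 = 0" "adot p4 V1 = 0"
      "adot V1 p1 = 0" "adot V1 p4 = 0" "adot p1 p4 = - 2 * k" "adot p4 p1 = - 2 * k"
    using seg by (auto simp: string_segment_def AdS_def k_def adot_commute)
  have D: "L\<^sup>2 + k * s * t > 0" if "s \<ge> 0" "t \<ge> 0" for s t
    using L k that by (intro add_pos_nonneg) auto
  have ws: "world_sheet L V1 p1 p4 s t =
      ((L\<^sup>2 - k * s * t) / (L\<^sup>2 + k * s * t)) *\<^sub>R V1 + (L\<^sup>2 * s / (L\<^sup>2 + k * s * t)) *\<^sub>R p1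
      + (L\<^sup>2 * t / (L\<^sup>2 + k * s * t)) *\<^sub>R p4" for s t
    by (simp add: world_sheet_def pp algebra_simps)
  \<comment> \<open>The derivative is two-sided even on the boundary of the unit square; it exists
    there because the denominator is positive at the point. A common scalar factor is pulled out so
    that the remaining tangent vector has polynomial coefficients.\<close>
  have dm: "vector_derivative (\<lambda>s. world_sheet L V1 p1 p4 s t) (at s) =
      (L\<^sup>2 / (L\<^sup>2 + k * s * t)\<^sup>2) *\<^sub>R ((- 2 * k * t) *\<^sub>R V1 + L\<^sup>2 *\<^sub>R p1 + (- k * t\<^sup>2) *\<^sub>R p4)"
    if "s \<ge> 0" "t \<ge> 0" for s t
  proof (rule vector_derivative_at)
    note D = D[OF that]
    have "((\<lambda>s. (L\<^sup>2 - k * s * t) / (L\<^sup>2 + k * s * t)) has_field_derivative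
        L\<^sup>2 / (L\<^sup>2 + k * s * t)\<^sup>2 * (- 2 * k * t)) (at s)"
      using D by (auto intro!: derivative_eq_intros simp: power2_eq_square) (simp add: field_simps)
    moreover have "((\<lambda>s. L\<^sup>2 * s / (L\<^sup>2 + k * s * t)) has_field_derivative
        L\<^sup>2 / (L\<^sup>2 + k * s * t)\<^sup>2 * L\<^sup>2) (at s)"
      using D by (auto intro!: derivative_eq_intros simp: power2_eq_square) (simp add: field_simps)
    moreover have "((\<lambda>s. L\<^sup>2 * t / (L\<^sup>2 + k * s * t)) has_field_derivative
        L\<^sup>2 / (L\<^sup>2 + k * s * t)\<^sup>2 * (- k * t\<^sup>2)) (at s)"
      using D by (auto intro!: derivative_eq_intros simp: power2_eq_square)
    \<comment> \<open>Only the scalar coefficients vary; \<open>V1\<close>, \<open>p1\<close>,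
      \<open>p4\<close> are constant, which removes one term of the product rule.\<close>
    ultimately show "((\<lambda>s. world_sheet L V1 p1 p4 s t) has_vector_derivative
        (L\<^sup>2 / (L\<^sup>2 + k * s * t)\<^sup>2) *\<^sub>R ((- 2 * k * t) *\<^sub>R V1 + L\<^sup>2 *\<^sub>R p1 + (- k * t\<^sup>2) *\<^sub>R p4)) (at s)"
      unfolding ws scaleR_add_right scaleR_scaleR
      by (intro has_vector_derivative_add has_vector_derivative_scaleR[where g' = 0, simplified])
         (auto intro: has_vector_derivative_const)
  qed
  have dp: "vector_derivative (\<lambda>t. world_sheet L V1 p1 p4 s t) (at t) =
      (L\<^sup>2 / (L\<^sup>2 + k * s * t)\<^sup>2) *\<^sub>R ((- 2 * k * s) *\<^sub>R V1 + (- k * s\<^sup>2) *\<^sub>R p1 + L\<^sup>2 *\<^sub>R p4)"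
    if "s \<ge> 0" "t \<ge> 0" for s t
  proof (rule vector_derivative_at)
    note D = D[OF that]
    have "((\<lambda>t. (L\<^sup>2 - k * s * t) / (L\<^sup>2 + k * s * t)) has_field_derivative
        L\<^sup>2 / (L\<^sup>2 + k * s * t)\<^sup>2 * (- 2 * k * s)) (at t)"
      using D by (auto intro!: derivative_eq_intros simp: power2_eq_square) (simp add: field_simps)
    moreover have "((\<lambda>t. L\<^sup>2 * s / (L\<^sup>2 + k * s * t)) has_field_derivative
        L\<^sup>2 / (L\<^sup>2 + k * s * t)\<^sup>2 * (- k * s\<^sup>2)) (at t)"
      using D by (auto intro!: derivative_eq_intros simp: power2_eq_square)
    moreover have "((\<lambda>t. L\<^sup>2 * t / (L\<^sup>2 + k * s * t)) has_field_derivative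
        L\<^sup>2 / (L\<^sup>2 + k * s * t)\<^sup>2 * L\<^sup>2) (at t)"
      using D by (auto intro!: derivative_eq_intros simp: power2_eq_square) (simp add: field_simps)
    ultimately show "((\<lambda>t. world_sheet L V1 p1 p4 s t) has_vector_derivative
        (L\<^sup>2 / (L\<^sup>2 + k * s * t)\<^sup>2) *\<^sub>R ((- 2 * k * s) *\<^sub>R V1 + (- k * s\<^sup>2) *\<^sub>R p1 + L\<^sup>2 *\<^sub>R p4)) (at t)"
      unfolding ws scaleR_add_right scaleR_scaleR
      by (intro has_vector_derivative_add has_vector_derivative_scaleR[where g' = 0, simplified])
         (auto intro: has_vector_derivative_const)
  qed
  have density: "sqrt (- det (induced_metric L V1 p1 p4 s t)) = 2 * k * L^4 / (L\<^sup>2 + k * s * t)\<^sup>2"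
    if "s \<ge> 0" "t \<ge> 0" for s t
  proof -
    note D = D[OF that]
    define d where "d = L\<^sup>2 + k * s * t"
    have d: "d > 0" using D by (simp add: d_def)
    define M P where "M = (- 2 * k * t) *\<^sub>R V1 + L\<^sup>2 *\<^sub>R p1 + (- k * t\<^sup>2) *\<^sub>R p4"
      and "P = (- 2 * k * s) *\<^sub>R V1 + (- k * s\<^sup>2) *\<^sub>R p1 + L\<^sup>2 *\<^sub>R p4"
    \<comment> \<open>In the two squares the contribution of \<open>adot V1 V1\<close> cancels that
      of \<open>adot p1 p4\<close>; in the mixed product they add up to a perfect square.\<close>
    have MP: "adot M M = 0" "adot P P = 0" "adot M P = - 2 * k * d\<^sup>2"
      unfolding M_def P_def adot_simps pp d_def by (simp_all add: power2_eq_square algebra_simps)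
    \<comment> \<open>With zero diagonal, minus the determinant is the square of the off-diagonal
      entry, and \<open>k > 0\<close> settles the sign of the root.\<close>
    have "- det (induced_metric L V1 p1 p4 s t) = ((L\<^sup>2 / d\<^sup>2)\<^sup>2 * (2 * k * d\<^sup>2))\<^sup>2"
      unfolding induced_metric_def dm[OF that] dp[OF that] M_def[symmetric] P_def[symmetric]
        d_def[symmetric] Let_def det_2
      by (simp add: adot_simps(3,4) MP adot_commute[of P M] power_mult_distrib power2_eq_square)
    also have "(L\<^sup>2 / d\<^sup>2)\<^sup>2 * (2 * k * d\<^sup>2) = 2 * k * L^4 / d\<^sup>2"
      using d by (simp add: field_simps)
    finally show ?thesis using k d by (simp add: d_def)
  qed
  have inner: "integral {0..1} (\<lambda>s. sqrt (- det (induced_metric L V1 p1 p4 s t)))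
      = 2 * k * L\<^sup>2 / (L\<^sup>2 + k * t)" if t: "t \<ge> 0" for t
  proof (rule integral_unique)
    \<comment> \<open>The antiderivative is the one vanishing at \<open>s = 0\<close>. The more
      obvious multiple of \<open>1 / (L\<^sup>2 + k * s * t)\<close> would carry a factor
      \<open>1 / t\<close> and fail at \<open>t = 0\<close>.\<close>
    have "((\<lambda>s. 2 * k * L^4 / (L\<^sup>2 + k * s * t)\<^sup>2) has_integral
        2 * k * L\<^sup>2 * 1 / (L\<^sup>2 + k * 1 * t) - 2 * k * L\<^sup>2 * 0 / (L\<^sup>2 + k * 0 * t)) {0..1}"
    proof (rule fundamental_theorem_of_calculus)
      fix s :: real assume "s \<in> {0..1}"
      then have D: "L\<^sup>2 + k * s * t > 0" using D t by simp
      have "((\<lambda>s. 2 * k * L\<^sup>2 * s / (L\<^sup>2 + k * s * t)) has_field_derivative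
          2 * k * L^4 / (L\<^sup>2 + k * s * t)\<^sup>2) (at s within {0..1})"
        using D by (auto intro!: derivative_eq_intros simp: power2_eq_square power4_eq_xxxx)
          (simp add: field_simps)
      then show "((\<lambda>s. 2 * k * L\<^sup>2 * s / (L\<^sup>2 + k * s * t)) has_vector_derivative
          2 * k * L^4 / (L\<^sup>2 + k * s * t)\<^sup>2) (at s within {0..1})"
        by (simp add: has_real_derivative_iff_has_vector_derivative)
    qed simp
    then have "((\<lambda>s. 2 * k * L^4 / (L\<^sup>2 + k * s * t)\<^sup>2) has_integral
        2 * k * L\<^sup>2 / (L\<^sup>2 + k * t)) {0..1}" by simp
    then show "((\<lambda>s. sqrt (- det (induced_metric L V1 p1 p4 s t))) has_integral
        2 * k * L\<^sup>2 / (L\<^sup>2 + k * t)) {0..1}"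
      by (rule has_integral_eq[rotated]) (simp add: density t)
  qed
  have "((\<lambda>t. 2 * k * L\<^sup>2 / (L\<^sup>2 + k * t)) has_integral
      2 * L\<^sup>2 * ln (L\<^sup>2 + k * 1) - 2 * L\<^sup>2 * ln (L\<^sup>2 + k * 0)) {0..1}"
  proof (rule fundamental_theorem_of_calculus)
    fix t :: real assume "t \<in> {0..1}"
    then have D: "L\<^sup>2 + k * t > 0" using D[of 1 t] by simp
    have "((\<lambda>t. 2 * L\<^sup>2 * ln (L\<^sup>2 + k * t)) has_field_derivative
        2 * k * L\<^sup>2 / (L\<^sup>2 + k * t)) (at t within {0..1})"
      using D by (auto intro!: derivative_eq_intros)
    then show "((\<lambda>t. 2 * L\<^sup>2 * ln (L\<^sup>2 + k * t)) has_vector_derivative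
        2 * k * L\<^sup>2 / (L\<^sup>2 + k * t)) (at t within {0..1})"
      by (simp add: has_real_derivative_iff_has_vector_derivative)
  qed simp
  then have "((\<lambda>t. integral {0..1} (\<lambda>s. sqrt (- det (induced_metric L V1 p1 p4 s t)))) has_integral
      2 * L\<^sup>2 * ln (L\<^sup>2 + k * 1) - 2 * L\<^sup>2 * ln (L\<^sup>2 + k * 0)) {0..1}"
    by (rule has_integral_eq[rotated]) (simp add: inner)
  then have "area L V1 p1 p4 = 2 * L\<^sup>2 * (ln (L\<^sup>2 + k) - ln (L\<^sup>2))"
    unfolding area_def by (simp add: integral_unique algebra_simps)
  also have "ln (L\<^sup>2 + k) - ln (L\<^sup>2) = ln (1 + k / L\<^sup>2)"
    using ln_div[of "L\<^sup>2 + k" "L\<^sup>2"] L2 k by (simp add: add_divide_distrib)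
  finally show ?thesis by simp
qed

text \<open>Each edge occurs once in the numerator and once in the denominator of \<open>C\<close>,
  so the light-cone components cancel and the area depends on the boundary points alone. The bound
  \<open>C > 1\<close> later allows division by \<open>C - 1\<close>.\<close>

lemma area_cross_ratio:
  fixes V1 p1 p4 :: "'n::finite ambient"
  assumes L: "L > 0" and seg: "string_segment L V1 p1 p4" and neg: "adot p1 p4 < 0"
    and bd: "boundary_points_defined L V1 p1 p4"
  defines "x1 \<equiv> boundary_point L p1" and "x2 \<equiv> boundary_point L (edge2 L V1 p1 p4)"
    and "x3 \<equiv> boundary_point L (edge3 L V1 p1 p4)" and "x4 \<equiv> boundary_point L p4"
  defines "C \<equiv> msq (x1 - x4) * msq (x2 - x3) / (msq (x1 - x2) * msq (x3 - x4))"
  shows "area L V1 p1 p4 / L\<^sup>2 = ln C" and "C > 1"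
proof -
  define k where "k = - adot p1 p4 / 2"
  have k: "k > 0" using neg by (simp add: k_def)
  have pp: "adot V1 V1 = - (L\<^sup>2)" "adot p1 p1 = 0" "adot p4 p4 = 0" "adot p1 V1 = 0" "adot p4 V1 = 0"
      "adot V1 p1 = 0" "adot V1 p4 = 0" "adot p1 p4 = - 2 * k" "adot p4 p1 = - 2 * k"
    using seg by (auto simp: string_segment_def AdS_def k_def adot_commute)
  define p2 p3 where "p2 = edge2 L V1 p1 p4" and "p3 = edge3 L V1 p1 p4"
  define D where "D = L\<^sup>2 + k"
  have D: "D > 0" using L k by (simp add: D_def add_pos_pos)
  have LD: "L\<^sup>2 = D - k" by (simp add: D_def)
  have L2: "L\<^sup>2 > 0" using L by simp
  have V3: "vertex3 L V1 p1 p4 = ((L\<^sup>2 - k) / D) *\<^sub>R V1 + (L\<^sup>2 / D) *\<^sub>R (p1 + p4)"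
    by (simp add: vertex3_def world_sheet_def pp D_def)
  have V2: "vertex2 L V1 p1 p4 = V1 + p1" and V4: "vertex4 L V1 p1 p4 = V1 + p4"
    using L by (simp_all add: vertex2_def vertex4_def world_sheet_def)
  \<comment> \<open>Coefficients of \<open>vertex3\<close> written as 1 minus a correction:
    subtracting \<open>V1 + p1\<close> or \<open>V1 + p4\<close> then leaves only the corrections on
    the subtracted vectors.\<close>
  have c: "(L\<^sup>2 - k) / D = 1 - 2 * k / D" "L\<^sup>2 / D = 1 - k / D"
    using D unfolding LD by (simp_all add: field_simps)
  have p2: "p2 = (- 2 * k / D) *\<^sub>R V1 + (- k / D) *\<^sub>R p1 + (L\<^sup>2 / D) *\<^sub>R p4"
    unfolding p2_def edge2_def V3 V2 c by (simp add: algebra_simps)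
  have p3: "p3 = (- 2 * k / D) *\<^sub>R V1 + (L\<^sup>2 / D) *\<^sub>R p1 + (- k / D) *\<^sub>R p4"
    unfolding p3_def edge3_def V3 V4 c by (simp add: algebra_simps)
  \<comment> \<open>The two remaining edges are null as well, so the boundary-point formula applies
    to them. Moreover \<open>p2\<close>, \<open>p3\<close> have the same product as
    \<open>p1\<close>, \<open>p4\<close>, while the two other neighbouring products are smaller by
    the factor \<open>L\<^sup>2 / D\<close>; this makes \<open>C\<close> a perfect square.\<close>
  have prods: "adot p2 p2 = 0" "adot p3 p3 = 0" "adot p1 p2 = - 2 * k * L\<^sup>2 / D"
      "adot p3 p4 = - 2 * k * L\<^sup>2 / D" "adot p2 p3 = - 2 * k"
    using D unfolding p2 p3 adot_simps pp LD
    by (simp_all add: field_simps power2_eq_square)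
  have lc: "lc_minus p1 \<noteq> 0" "lc_minus p2 \<noteq> 0" "lc_minus p3 \<noteq> 0" "lc_minus p4 \<noteq> 0"
    using bd by (auto simp: boundary_points_defined_def p2_def p3_def)
  have L0: "L \<noteq> 0" using L by simp
  note nb = adot_null_boundary_point[OF L0]
  define c where "c p q = - lc_minus p * lc_minus q / (2 * L\<^sup>2)" for p q :: "'n ambient"
  have c0: "c p q \<noteq> 0" if "lc_minus p \<noteq> 0" "lc_minus q \<noteq> 0" for p q
    using that L0 by (simp add: c_def)
  have e: "adot p1 p4 = c p1 p4 * msq (x1 - x4)" "adot p2 p3 = c p2 p3 * msq (x2 - x3)"
      "adot p1 p2 = c p1 p2 * msq (x1 - x2)" "adot p3 p4 = c p3 p4 * msq (x3 - x4)"
    unfolding c_def x1_def x2_def x3_def x4_def p2_def[symmetric] p3_def[symmetric]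
    by (rule nb; fact pp prods lc)+
  have cc: "c p1 p4 * c p2 p3 = c p1 p2 * c p3 p4" by (simp add: c_def)
  \<comment> \<open>Numerator and denominator are extended by equal nonzero prefactors, which turns
    squared distances into ambient products.\<close>
  have "C = (c p1 p4 * c p2 p3 * (msq (x1 - x4) * msq (x2 - x3))) /
      (c p1 p2 * c p3 p4 * (msq (x1 - x2) * msq (x3 - x4)))"
    unfolding cc C_def using c0[OF lc(1,2)] c0[OF lc(3,4)] by simp
  also have "\<dots> = (adot p1 p4 * adot p2 p3) / (adot p1 p2 * adot p3 p4)"
    unfolding e by (simp add: ac_simps)
  also have "\<dots> = (D / L\<^sup>2)\<^sup>2"
    unfolding prods pp using k D L0 by (simp add: field_simps power2_eq_square)
  also have "D / L\<^sup>2 = 1 + k / L\<^sup>2" using L0 by (simp add: D_def field_simps)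
  finally have C: "C = (1 + k / L\<^sup>2)\<^sup>2" .
  have "k / L\<^sup>2 > 0" using k L2 by simp
  then show "C > 1" unfolding C by (intro one_less_power) auto
  have "area L V1 p1 p4 = L\<^sup>2 * (2 * ln (1 + k / L\<^sup>2))"
    using area_eq[OF L seg neg] by (simp add: k_def)
  then show "area L V1 p1 p4 / L\<^sup>2 = ln C"
    unfolding C using L0 \<open>k / L\<^sup>2 > 0\<close> by (simp add: ln_realpow)
qed

subsection \<open>Expansion of the cross-ratio\<close>

lemma kin_ds2_mprod:
  "kin_ds2 ell x y u v = 4 * ell\<^sup>2 / msq (x - y) *
     (- mprod u v + 2 * mprod (x - y) u * mprod (x - y) v / msq (x - y))"
proof -
  define m where "m = msq (x - y)"
  define w where "w \<mu> = lower x \<mu> - lower y \<mu>" for \<mu>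
  have w: "w \<mu> = lower (x - y) \<mu>" for \<mu> by (simp add: w_def lower_eq)
  have "kin_ds2 ell x y u v = (\<Sum>\<mu>\<in>UNIV. \<Sum>\<nu>\<in>UNIV.
      4 * ell\<^sup>2 / m * (- (eta \<mu> \<nu> * u $ \<mu> * v $ \<nu>) + 2 / m * ((w \<mu> * u $ \<mu>) * (w \<nu> * v $ \<nu>))))"
    unfolding kin_ds2_def kin_metric_def m_def[symmetric] w_def[symmetric]
    \<comment> \<open>For \<open>m = 0\<close> both sides vanish, since division by zero gives
      0.\<close>
    by (intro sum.cong refl) (cases "m = 0"; simp add: field_simps)
  \<comment> \<open>The second term is a product of a factor in \<mu> and a factor in \<nu>, so its
    double sum splits into a product of two sums.\<close>
  also have "\<dots> = 4 * ell\<^sup>2 / m * (- mprod u v + 2 / m * (mprod (x - y) u * mprod (x - y) v))"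
    unfolding sum_distrib_left[symmetric] sum.distrib sum_negf sum_product[symmetric]
    by (simp add: mprod_def[of u v] mprod_lower[of "x - y"] w sum_negf sum_distrib_right)
  finally show ?thesis by (simp add: m_def)
qed

text \<open>This is the numerator of the cross-ratio minus 1. Every term on the right contains both
  \<open>a\<close> and \<open>b\<close>; the bilinear ones give the metric, the others are of total
  degree 3 or 4.\<close>

lemma mixed_difference_msq:
  "msq z * msq (z + a - b) - msq (z - b) * msq (z + a) =
     - 2 * msq z * mprod a b + 4 * mprod z a * mprod z b
     + 2 * mprod z b * msq a - 2 * mprod z a * msq b - msq a * msq b"
  unfolding msq_def mprod_simps mprod_commute[of a z] mprod_commute[of b z] mprod_commute[of b a]
  by (simp add: algebra_simps)

text \<open>Substituting \<open>a = t A\<close> and \<open>b = t B\<close> makes the mixed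
  difference divisible by \<open>t\<^sup>2\<close>, and the quotient converges once \<open>A\<close>
  and \<open>B\<close> do.\<close>

lemma tendsto_cross_ratio:
  fixes a b :: "real \<Rightarrow> 'n::finite mink"
  assumes z: "msq z \<noteq> 0"
    and a: "((\<lambda>t. a t /\<^sub>R t) \<longlongrightarrow> u) (at_right 0)" and b: "((\<lambda>t. b t /\<^sub>R t) \<longlongrightarrow> v) (at_right 0)"
  shows "((\<lambda>t. (msq z * msq (z + a t - b t) / (msq (z - b t) * msq (z + a t)) - 1) / t\<^sup>2) \<longlongrightarrow>
           2 / msq z * (- mprod u v + 2 * mprod z u * mprod z v / msq z)) (at_right 0)"
proof -
  define A B where "A t = a t /\<^sub>R t" and "B t = b t /\<^sub>R t" for t
  have A: "(A \<longlongrightarrow> u) (at_right 0)" and B: "(B \<longlongrightarrow> v) (at_right 0)"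
    using a b by (simp_all add: A_def[abs_def] B_def[abs_def])
  \<comment> \<open>The mixed difference divided by \<open>t\<^sup>2\<close>: cubic terms keep one
    factor \<open>t\<close>, the quartic term keeps two, and both disappear in the limit.\<close>
  define N where "N t = - 2 * msq z * mprod (A t) (B t) + 4 * mprod z (A t) * mprod z (B t)
     + t * (2 * mprod z (B t) * msq (A t) - 2 * mprod z (A t) * msq (B t))
     - t\<^sup>2 * (msq (A t) * msq (B t))" for t
  define M where "M t = msq (z - t *\<^sub>R B t) * msq (z + t *\<^sub>R A t)" for t
  have M: "(M \<longlongrightarrow> msq (z - 0 *\<^sub>R v) * msq (z + 0 *\<^sub>R u)) (at_right 0)"
    unfolding M_def msq_def by (intro tendsto_intros A B)
  have N: "(N \<longlongrightarrow> - 2 * msq z * mprod u v + 4 * mprod z u * mprod z v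
     + 0 * (2 * mprod z v * msq u - 2 * mprod z u * msq v) - 0\<^sup>2 * (msq u * msq v)) (at_right 0)"
    unfolding N_def msq_def by (intro tendsto_intros A B)
  have "((\<lambda>t. N t / M t) \<longlongrightarrow>
      (- 2 * msq z * mprod u v + 4 * mprod z u * mprod z v) / (msq z * msq z)) (at_right 0)"
    using tendsto_divide[OF N M] z by simp
  also have "(- 2 * msq z * mprod u v + 4 * mprod z u * mprod z v) / (msq z * msq z) =
      2 / msq z * (- mprod u v + 2 * mprod z u * mprod z v / msq z)"
    using z by (simp add: field_simps)
  finally have lim: "((\<lambda>t. N t / M t) \<longlongrightarrow> \<dots>) (at_right 0)" .
  have M0: "\<forall>\<^sub>F t in at_right 0. M t \<noteq> 0"
    using M by (rule tendsto_imp_eventually_ne) (use z in simp)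
  have "\<forall>\<^sub>F t in at_right 0. N t / M t =
      (msq z * msq (z + a t - b t) / (msq (z - b t) * msq (z + a t)) - 1) / t\<^sup>2"
    using M0 eventually_at_right_less
  proof eventually_elim
    case (elim t)
    have ab: "a t = t *\<^sub>R A t" "b t = t *\<^sub>R B t" using elim by (simp_all add: A_def B_def)
    have "msq z * msq (z + a t - b t) - M t = t\<^sup>2 * N t"
      unfolding M_def ab mixed_difference_msq N_def
      by (simp add: msq_def mprod_simps power2_eq_square algebra_simps)
    then have "msq z * msq (z + a t - b t) / M t - 1 = t\<^sup>2 * N t / M t"
      using elim by (simp add: field_simps)
    then show ?case using elim by (simp add: M_def ab)
  qed
  with lim show ?thesis by (rule Lim_transform_eventually)
qed

text \<open>A quadratic remainder divided by \<open>t\<close> is still bounded by a multiple of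
  \<open>t\<close>. This turns the given expansions of the boundary points into limits of difference
  quotients.\<close>

lemma tendsto_difference_quotient_bigo:
  fixes f :: "real \<Rightarrow> 'a::real_normed_vector"
  assumes "(\<lambda>t. norm (f t - (w + t *\<^sub>R u))) \<in> O[at_right 0](\<lambda>t. t\<^sup>2)"
  shows "((\<lambda>t. (f t - w) /\<^sub>R t) \<longlongrightarrow> u) (at_right 0)"
proof -
  obtain c where c: "\<forall>\<^sub>F t in at_right 0. norm (f t - (w + t *\<^sub>R u)) \<le> c * t\<^sup>2"
    using assms by (auto elim!: landau_o.bigE)
  have "\<forall>\<^sub>F t in at_right 0. norm ((f t - w) /\<^sub>R t - u) \<le> c * t"
    using c eventually_at_right_less
  proof eventually_elim
    case (elim t)
    have "(f t - w) /\<^sub>R t - u = (f t - (w + t *\<^sub>R u)) /\<^sub>R t"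
      using elim by (simp add: algebra_simps)
    then have "norm ((f t - w) /\<^sub>R t - u) = norm (f t - (w + t *\<^sub>R u)) / t"
      using elim by (simp add: divide_inverse mult.commute)
    also have "\<dots> \<le> c * t\<^sup>2 / t" using elim by (intro divide_right_mono) auto
    finally show ?case using elim by (simp add: power2_eq_square)
  qed
  moreover have "((\<lambda>t. c * t) \<longlongrightarrow> c * 0) (at_right 0)"
    by (intro tendsto_intros)
  ultimately have "((\<lambda>t. (f t - w) /\<^sub>R t - u) \<longlongrightarrow> 0) (at_right 0)"
    by (auto intro: Lim_null_comparison)
  then show ?thesis by (simp add: Lim_null[symmetric])
qed

text \<open>The quotient of \<open>ln C\<close> by \<open>C - 1\<close> tends to 1 as
  \<open>C\<close> tends to 1, so the logarithm may be replaced by \<open>C - 1\<close>.\<close>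

lemma tendsto_ln_divide_square:
  fixes C :: "real \<Rightarrow> real"
  assumes lim: "((\<lambda>t. (C t - 1) / t\<^sup>2) \<longlongrightarrow> c) (at_right 0)"
    and C: "\<forall>\<^sub>F t in at_right 0. C t > 1"
  shows "((\<lambda>t. ln (C t) / t\<^sup>2) \<longlongrightarrow> c) (at_right 0)"
proof -
  \<comment> \<open>Multiplying the convergent quotient back by \<open>t\<^sup>2\<close> shows that
    \<open>C\<close> tends to 1.\<close>
  have "((\<lambda>t. (C t - 1) / t\<^sup>2 * t\<^sup>2) \<longlongrightarrow> c * 0\<^sup>2) (at_right 0)"
    by (intro tendsto_intros lim)
  moreover have "\<forall>\<^sub>F t in at_right 0. (C t - 1) / t\<^sup>2 * t\<^sup>2 = C t - 1"
    using eventually_at_right_less[of "0::real"] by eventually_elim simp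
  ultimately have "((\<lambda>t. C t - 1) \<longlongrightarrow> 0) (at_right 0)"
    by (simp add: Lim_transform_eventually)
  \<comment> \<open>The logarithm limit is taken over a punctured neighbourhood of 0;
    \<open>C t > 1\<close> keeps \<open>C t - 1\<close> away from 0.\<close>
  then have "filterlim (\<lambda>t. C t - 1) (at 0) (at_right 0)"
    by (rule filterlim_atI) (use C in \<open>auto elim: eventually_mono\<close>)
  from filterlim_compose[OF lim_ln_1_plus_x_over_x_at_0 this]
  have "((\<lambda>t. ln (1 + (C t - 1)) / (C t - 1) * ((C t - 1) / t\<^sup>2)) \<longlongrightarrow> 1 * c) (at_right 0)"
    by (intro tendsto_mult lim)
  moreover have "\<forall>\<^sub>F t in at_right 0.
      ln (1 + (C t - 1)) / (C t - 1) * ((C t - 1) / t\<^sup>2) = ln (C t) / t\<^sup>2"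
    using C by eventually_elim simp
  ultimately show ?thesis by (simp add: Lim_transform_eventually)
qed

section \<open>Asymptotics of the area along the family of segments\<close>

theorem mainTheorem4:
  fixes L ell :: real
    and x y \<xi> \<eta> :: "'n::finite mink"
    and V1 p1 p4 :: "real \<Rightarrow> 'n ambient"
  assumes "L > 0" and "ell > 0"
    and "(x, y) \<in> kinematic_space"
    and "\<forall>\<^sub>F \<epsilon> in at_right 0.
           string_segment L (V1 \<epsilon>) (p1 \<epsilon>) (p4 \<epsilon>) \<and>
           boundary_points_defined L (V1 \<epsilon>) (p1 \<epsilon>) (p4 \<epsilon>) \<and>
           causality L (V1 \<epsilon>) (p1 \<epsilon>) (p4 \<epsilon>)"
    and "\<forall>\<^sub>F \<epsilon> in at_right 0. boundary_point L (p1 \<epsilon>) = x"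
    and "\<forall>\<^sub>F \<epsilon> in at_right 0. boundary_point L (p4 \<epsilon>) = y"
    and "(\<lambda>\<epsilon>. norm (boundary_point L (edge3 L (V1 \<epsilon>) (p1 \<epsilon>) (p4 \<epsilon>)) - (x + \<epsilon> *\<^sub>R \<xi>)))
           \<in> O[at_right 0](\<lambda>\<epsilon>. \<epsilon>\<^sup>2)"
    and "(\<lambda>\<epsilon>. norm (boundary_point L (edge2 L (V1 \<epsilon>) (p1 \<epsilon>) (p4 \<epsilon>)) - (y + \<epsilon> *\<^sub>R \<eta>)))
           \<in> O[at_right 0](\<lambda>\<epsilon>. \<epsilon>\<^sup>2)"
  shows "(\<lambda>\<epsilon>. area L (V1 \<epsilon>) (p1 \<epsilon>) (p4 \<epsilon>) / L\<^sup>2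
            - \<epsilon>\<^sup>2 / (2 * ell\<^sup>2) *
                (\<Sum>\<mu>\<in>UNIV. \<Sum>\<nu>\<in>UNIV. kin_metric ell x y \<mu> \<nu> * \<xi> $ \<mu> * \<eta> $ \<nu>))
           \<in> o[at_right 0](\<lambda>\<epsilon>. \<epsilon>\<^sup>2)
       \<and> (\<lambda>\<epsilon>. area L (V1 \<epsilon>) (p1 \<epsilon>) (p4 \<epsilon>) / L\<^sup>2
            - 1 / (2 * ell\<^sup>2) * kin_ds2 ell x y (\<epsilon> *\<^sub>R \<xi>) (\<epsilon> *\<^sub>R \<eta>))
           \<in> o[at_right 0](\<lambda>\<epsilon>. \<epsilon>\<^sup>2)"
proof -
  define X2 where "X2 \<epsilon> = boundary_point L (edge2 L (V1 \<epsilon>) (p1 \<epsilon>) (p4 \<epsilon>))" for \<epsilon>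
  define X3 where "X3 \<epsilon> = boundary_point L (edge3 L (V1 \<epsilon>) (p1 \<epsilon>) (p4 \<epsilon>))" for \<epsilon>
  \<comment> \<open>With these displacements, \<open>z + a - b\<close> is \<open>X3 - X2\<close>,
    \<open>z - b\<close> is \<open>x - X2\<close> and \<open>z + a\<close> is \<open>X3 - y\<close>,
    so \<open>C\<close> below is the boundary cross-ratio up to the sign of one difference, which
    \<open>msq\<close> ignores.\<close>
  define z a b where "z = x - y" and "a \<epsilon> = X3 \<epsilon> - x" and "b \<epsilon> = X2 \<epsilon> - y" for \<epsilon>
  define C where "C t = msq z * msq (z + a t - b t) / (msq (z - b t) * msq (z + a t))" for t
  define h where "h = kin_ds2 ell x y \<xi> \<eta>"
  have z: "msq z \<noteq> 0" using assms(3) by (auto simp: kinematic_space_def z_def)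
  have msq_minus: "msq (v - u) = msq (u - v)" for u v :: "'n mink"
    by (simp add: msq_def mprod_inner inner_simps algebra_simps)
  have ev: "\<forall>\<^sub>F \<epsilon> in at_right 0. C \<epsilon> > 1 \<and> area L (V1 \<epsilon>) (p1 \<epsilon>) (p4 \<epsilon>) / L\<^sup>2 = ln (C \<epsilon>)"
    using assms(4,5,6)
  proof eventually_elim
    case (elim \<epsilon>)
    have neg: "adot (p1 \<epsilon>) (p4 \<epsilon>) < 0" using elim(1) by (simp add: causality_def Let_def)
    have "C \<epsilon> = msq (x - y) * msq (X2 \<epsilon> - X3 \<epsilon>) / (msq (x - X2 \<epsilon>) * msq (X3 \<epsilon> - y))"
      using msq_minus[of "X3 \<epsilon>" "X2 \<epsilon>"] by (simp add: C_def z_def a_def b_def algebra_simps)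
    then show ?case
      using area_cross_ratio[of L "V1 \<epsilon>" "p1 \<epsilon>" "p4 \<epsilon>"] elim assms(1) neg
      by (simp add: X2_def X3_def)
  qed
  \<comment> \<open>The factor \<open>4 * ell\<^sup>2\<close> of the kinematic metric against
    \<open>1 / (2 * ell\<^sup>2)\<close> leaves the 2 of the cross-ratio limit; the length scale
    drops out.\<close>
  have scale_ell: "2 / m * Q = 4 * ell\<^sup>2 / m * Q / (2 * ell\<^sup>2)" for m Q
    using assms(2) by simp
  have "((\<lambda>\<epsilon>. (C \<epsilon> - 1) / \<epsilon>\<^sup>2) \<longlongrightarrow>
      2 / msq z * (- mprod \<xi> \<eta> + 2 * mprod z \<xi> * mprod z \<eta> / msq z)) (at_right 0)"
    unfolding C_def using z
    by (rule tendsto_cross_ratio)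
       (use assms(7,8) in \<open>auto simp: a_def b_def X2_def X3_def
          intro: tendsto_difference_quotient_bigo\<close>)
  also have "2 / msq z * (- mprod \<xi> \<eta> + 2 * mprod z \<xi> * mprod z \<eta> / msq z) = h / (2 * ell\<^sup>2)"
    unfolding h_def kin_ds2_mprod z_def[symmetric] by (rule scale_ell)
  finally have "((\<lambda>\<epsilon>. ln (C \<epsilon>) / \<epsilon>\<^sup>2) \<longlongrightarrow> h / (2 * ell\<^sup>2)) (at_right 0)"
    by (rule tendsto_ln_divide_square) (use ev in \<open>auto elim: eventually_mono\<close>)
  then have lim: "((\<lambda>\<epsilon>. ln (C \<epsilon>) / \<epsilon>\<^sup>2 - h / (2 * ell\<^sup>2)) \<longlongrightarrow> 0) (at_right 0)"
    by (simp add: Lim_null[symmetric])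
  have "\<forall>\<^sub>F \<epsilon> in at_right 0. ln (C \<epsilon>) / \<epsilon>\<^sup>2 - h / (2 * ell\<^sup>2) =
      (area L (V1 \<epsilon>) (p1 \<epsilon>) (p4 \<epsilon>) / L\<^sup>2 - \<epsilon>\<^sup>2 / (2 * ell\<^sup>2) * h) / \<epsilon>\<^sup>2"
    using ev eventually_at_right_less[of "0::real"]
    by eventually_elim (simp add: diff_divide_distrib)
  with lim have "((\<lambda>\<epsilon>. (area L (V1 \<epsilon>) (p1 \<epsilon>) (p4 \<epsilon>) / L\<^sup>2 - \<epsilon>\<^sup>2 / (2 * ell\<^sup>2) * h) / \<epsilon>\<^sup>2) \<longlongrightarrow> 0)
      (at_right 0)"
    by (rule Lim_transform_eventually)
  then have main: "(\<lambda>\<epsilon>. area L (V1 \<epsilon>) (p1 \<epsilon>) (p4 \<epsilon>) / L\<^sup>2 - \<epsilon>\<^sup>2 / (2 * ell\<^sup>2) * h)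
      \<in> o[at_right 0](\<lambda>\<epsilon>. \<epsilon>\<^sup>2)"
    by (rule smalloI_tendsto)
       (use eventually_at_right_less[of "0::real"] in \<open>auto elim: eventually_mono\<close>)
  \<comment> \<open>Bilinearity of the line element in the two displacements makes both conjuncts
    the same assertion.\<close>
  have scale: "1 / (2 * ell\<^sup>2) * kin_ds2 ell x y (\<epsilon> *\<^sub>R \<xi>) (\<epsilon> *\<^sub>R \<eta>) = \<epsilon>\<^sup>2 / (2 * ell\<^sup>2) * h" for \<epsilon>
  proof -
    have "kin_ds2 ell x y (\<epsilon> *\<^sub>R \<xi>) (\<epsilon> *\<^sub>R \<eta>) = \<epsilon>\<^sup>2 * h"
      unfolding h_def kin_ds2_def by (simp add: sum_distrib_left power2_eq_square ac_simps)
    then show ?thesis by simp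
  qed
  show ?thesis
    using main unfolding scale by (simp add: h_def kin_ds2_def)
qed

end
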